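(* For $i=1,2$ let $\alpha_i\in[-1,1]$ and let $f_{\alpha_i}=h_{\alpha_i}+\overline{g_{\alpha_i}}\in S_H$ with $h_{\alpha_i}(z)+g_{\alpha_i}(z)=\dfrac{z(1-\alpha_i z)}{1-z^2}$. Suppose the dilatation of $f_{\alpha_1}$ is $\omega_1(z)=-z$ and let $\omega_2$ be the dilatation of $f_{\alpha_2}$. Let $0\le t\le1$ and $f=tf_{\alpha_1}+(1-t)f_{\alpha_2}$. Then: (i) if $\omega_2(z)=-z^2$ and $\alpha_1\ge\alpha_2$, then $f\in S_H$ and $f$ maps $E$ onto a domain convex in the direction of the imaginary axis; (ii) if $\omega_2(z)=z^2$, $|\alpha_1|\ge|\alpha_2|$ and $\alpha_1\alpha_2\ge0$, then $f\in S_H$ and $f$ maps $E$ onto a domain convex in the direction of the imaginary axis.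
   Context: $E=\{z\in\mathbb{C}:|z|<1\}$. For a harmonic mapping $f=h+\overline{g}$ on $E$ with $h,g$ analytic, the dilatation is $\omega=g'/h'$; $f$ is locally univalent and sense-preserving iff $h'\ne0$ and $|\omega|<1$ in $E$. $S_H$ denotes the class of harmonic, univalent, sense-preserving mappings $f=h+\overline{g}$ of $E$ normalized by $f(0)=0$, $f_z(0)=1$. A domain $\Omega$ is convex in the direction of the imaginary axis if every line parallel to the imaginary axis has connected or empty intersection with $\Omega$. *)

theory Defs
  imports "HOL-Analysis.Analysis"
begin

definition unit_disk :: "complex set" where
  "unit_disk = ball 0 1"

text \<open>The class S_H: harmonic, univalent, sense-preserving mappings f = h + conj g of E
  with h, g analytic on E, f(0) = 0 and f_z(0) = h'(0) = 1.  Sense-preserving and locally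
  univalent means h' nonzero and the dilatation g'/h' has modulus < 1 on E.\<close>
definition in_SH :: "(complex \<Rightarrow> complex) \<Rightarrow> bool" where
  "in_SH f \<longleftrightarrow>
     (\<exists>h g. h holomorphic_on unit_disk \<and> g holomorphic_on unit_disk \<and>
        (\<forall>z\<in>unit_disk. f z = h z + cnj (g z)) \<and>
        inj_on f unit_disk \<and>
        (\<forall>z\<in>unit_disk. deriv h z \<noteq> 0 \<and> norm (deriv g z / deriv h z) < 1) \<and>
        f 0 = 0 \<and> deriv h 0 = 1)"

definition convex_imag_dir :: "complex set \<Rightarrow> bool" where
  "convex_imag_dir \<Omega> \<longleftrightarrow> (\<forall>x::real. connected (\<Omega> \<inter> {w. Re w = x}))"

end

theory Submission
  imports Defs "HOL-Complex_Analysis.Complex_Analysis"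
begin

text \<open>Local univalence: writing f = h + cnj g for the combination, in both cases the dilatation is
  g'/h' = -z P/P*, where P is a real monic polynomial (of degree 3, resp. 4) and P* its reversal.
  Schur--Cohn reduction, P \<mapsto> (P - P(0) P*)/z up to scaling, shows \<bar>P\<bar> \<le> \<bar>P*\<bar> \<noteq> 0 in the
  disk, and this is where the conditions on the parameters enter.

  Univalence and convexity (a form of the Clunie--Sheil-Small shear): h + g has again the form
  F(z) = z(1 - \<alpha>z)/(1 - z^2), and Re f = Re F. In the half-plane coordinate \<zeta> = (1 + z)/(1 - z)
  the function F is a\<zeta> - b/\<zeta> up to a constant, with a, b \<ge> 0, so that a nonempty level set of Re F
  meets every ray \<zeta> = x(1 + im), x > 0, exactly once and is a regular curve parametrised by the
  slope m. Along it Im f has no critical point, as \<bar>g'\<bar> < \<bar>h'\<bar>.\<close>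

section \<open>Schur--Cohn reduction for real polynomials of degree at most three\<close>

text \<open>The identity |Ps - c P|^2 - |P - c Ps|^2 = (1 - c^2)(|Ps|^2 - |P|^2) carries the
  inequality for the reduced pair \<open>R\<close>, \<open>Rs\<close> back to \<open>P\<close>,
  \<open>Ps\<close>. The factor \<open>z\<close> in \<open>eq\<close> makes the result strict
  although the bound on \<open>R\<close> is weak.\<close>

lemma schur_step:
  fixes c k :: real and z P Ps R Rs :: complex
  assumes c: "\<bar>c\<bar> < 1" and z: "norm z < 1" and R: "norm R \<le> norm Rs" "Rs \<noteq> 0" and k: "k \<noteq> 0"
    and eq: "P - of_real c * Ps = of_real k * (z * R)" "Ps - of_real c * P = of_real k * Rs"
  shows "norm P < norm Ps"
proof -
  have "norm z * norm R < norm Rs"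
    using mult_left_mono[OF R(1), of "norm z"] mult_strict_right_mono[OF z, of "norm Rs"] R(2)
    by (auto intro: le_less_trans)
  then have "norm (P - of_real c * Ps) < norm (Ps - of_real c * P)"
    using k by (simp add: eq norm_mult)
  then have "(norm (P - of_real c * Ps))\<^sup>2 < (norm (Ps - of_real c * P))\<^sup>2"
    by (intro power_strict_mono) auto
  then have "0 < (1 - c\<^sup>2) * ((norm Ps)\<^sup>2 - (norm P)\<^sup>2)"
    unfolding cmod_power2 by (simp add: power2_eq_square algebra_simps)
  moreover have "1 - c\<^sup>2 > 0" using c by (simp add: abs_square_less_1)
  ultimately have "(norm P)\<^sup>2 < (norm Ps)\<^sup>2" by (simp add: zero_less_mult_iff)
  then show ?thesis by (rule power_less_imp_less_base) simp
qed

text \<open>The difference of the squared moduli is (A^2 - B^2)(1 - |z|^2). It vanishes for |B| = A,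
  so the base of the reduction can only give a weak inequality.\<close>

lemma schur_linear:
  fixes A B :: real and z :: complex
  assumes "A > 0" "\<bar>B\<bar> \<le> A" "norm z < 1"
  shows "norm (of_real A * z + of_real B) \<le> norm (of_real B * z + of_real A)"
    and "of_real B * z + of_real A \<noteq> 0"
proof -
  have z: "(norm z)\<^sup>2 < 1" using assms(3) by (simp add: abs_square_less_1)
  have B: "B\<^sup>2 \<le> A\<^sup>2" using assms(1,2) by (simp add: abs_le_square_iff[symmetric])
  have "(norm (of_real B * z + of_real A))\<^sup>2 - (norm (of_real A * z + of_real B))\<^sup>2
      = (A\<^sup>2 - B\<^sup>2) * (1 - (norm z)\<^sup>2)"
    unfolding cmod_power2 by (simp add: power2_eq_square algebra_simps)
  moreover have "\<dots> \<ge> 0" using z B by simp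
  ultimately have "(norm (of_real A * z + of_real B))\<^sup>2 \<le> (norm (of_real B * z + of_real A))\<^sup>2"
    by linarith
  then show "norm (of_real A * z + of_real B) \<le> norm (of_real B * z + of_real A)"
    by (rule power2_le_imp_le) simp
  show "of_real B * z + of_real A \<noteq> 0"
  proof
    assume "of_real B * z + of_real A = 0"
    then have "of_real A = - (of_real B * z)" by (simp add: add_eq_0_iff)
    then have "norm (of_real A :: complex) = norm (of_real B * z)" by (metis norm_minus_cancel)
    then have "A = \<bar>B\<bar> * norm z" using assms(1) by (simp add: norm_mult)
    also have "\<dots> \<le> A * norm z" using assms(2) by (intro mult_right_mono) auto
    also have "\<dots> < A * 1" using assms(1,3) by (intro mult_strict_left_mono)
    finally show False by simp
  qed
qed

text \<open>One reduction with c = C/A leaves (A + C) z + B, to which \<open>schur_linear\<close>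
  applies because |B| \<le> A + C. The reduction needs |c| < 1, so C = A and C = -A are treated
  directly.\<close>

lemma schur_quadratic:
  fixes A B C :: real and z :: complex
  defines "Q \<equiv> of_real A * z\<^sup>2 + of_real B * z + of_real C"
    and "Qs \<equiv> of_real C * z\<^sup>2 + of_real B * z + of_real A"
  assumes A: "A > 0" and C: "\<bar>C\<bar> \<le> A" and B: "\<bar>B\<bar> \<le> A + C" and z: "norm z < 1"
  shows "norm Q \<le> norm Qs" "Qs \<noteq> 0"
proof -
  have z2: "(Re z)\<^sup>2 + (Im z)\<^sup>2 < 1"
    using z by (simp add: abs_square_less_1 flip: cmod_power2)
  consider "\<bar>C\<bar> < A" | "C = A" | "C = - A" using C by linarith
  then have "norm Q \<le> norm Qs \<and> Qs \<noteq> 0"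
  proof cases
    case 1
    have "norm Q < norm Qs"
    proof (rule schur_step)
      show "\<bar>C / A\<bar> < 1" "norm z < 1" "1 - C / A \<noteq> 0" using 1 A z by (auto simp: field_simps)
      show "norm (of_real (A + C) * z + of_real B) \<le> norm (of_real B * z + of_real (A + C))"
        "of_real B * z + of_real (A + C) \<noteq> 0"
        using 1 B z schur_linear[of "A + C" B z] by auto
      show "Q - of_real (C / A) * Qs = of_real (1 - C / A) * (z * (of_real (A + C) * z + of_real B))"
        "Qs - of_real (C / A) * Q = of_real (1 - C / A) * (of_real B * z + of_real (A + C))"
        unfolding Q_def Qs_def using A by (simp_all add: field_simps power2_eq_square)
    qed
    then show ?thesis by auto
  next
    case 2
    \<comment> \<open>\<open>Q\<close> is its own reversal here, so only zeros have to be excluded.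
      A real zero contradicts |B| \<le> 2A, because A (1 - |z|)^2 > 0; a non-real one satisfies
      |z|^2 = C/A = 1, the product of two conjugate roots.\<close>
    have "Q \<noteq> 0"
    proof
      assume 0: "Q = 0"
      then have "Re Q = 0" "Im Q = 0" by auto
      then have re: "A * ((Re z)\<^sup>2 - (Im z)\<^sup>2) + B * Re z + A = 0"
        and im: "Im z * (2 * A * Re z + B) = 0"
        unfolding Q_def 2 by (simp_all add: power2_eq_square algebra_simps)
      from im consider "Im z = 0" | "B = - (2 * A * Re z)" by (auto simp: add_eq_0_iff)
      then show False
      proof cases
        case 1
        have "\<bar>Re z\<bar> < 1" using z2 1 by (simp add: abs_square_less_1)
        have "\<bar>B * Re z\<bar> \<le> (2 * A) * \<bar>Re z\<bar>"
          unfolding abs_mult using B 2 by (intro mult_right_mono) auto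
        moreover have "A * (1 - \<bar>Re z\<bar>)\<^sup>2 > 0" using A \<open>\<bar>Re z\<bar> < 1\<close> by simp
        moreover have "A * (1 - \<bar>Re z\<bar>)\<^sup>2 = A * (Re z)\<^sup>2 + A - (2 * A) * \<bar>Re z\<bar>"
          by (simp add: power2_diff algebra_simps)
        ultimately show False using re 1 by simp
      next
        case 2
        then have "A * (1 - ((Re z)\<^sup>2 + (Im z)\<^sup>2)) = 0"
          using re by (simp add: power2_eq_square algebra_simps)
        then show False using A z2 by simp
      qed
    qed
    moreover have "Q = Qs" unfolding Q_def Qs_def 2 by simp
    ultimately show ?thesis by simp
  next
    case 3
    then have [simp]: "B = 0" using B by simp
    have "Qs = of_real A * (1 - z\<^sup>2)" "Q = - Qs" unfolding Q_def Qs_def 3 by (simp_all add: algebra_simps)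
    moreover have "z\<^sup>2 \<noteq> 1" using z by (auto simp: power2_eq_1_iff)
    ultimately show ?thesis using A by simp
  qed
  then show "norm Q \<le> norm Qs" "Qs \<noteq> 0" by auto
qed

text \<open>One reduction with c = d/a, scaled by a, leaves a quadratic with coefficients a^2 - d^2,
  ab - dc, ac - db; \<open>r0\<close> and \<open>r1\<close> are the hypotheses of
  \<open>schur_quadratic\<close> for it.\<close>

lemma schur_cubic:
  fixes a b c d :: real and z :: complex
  defines "Q \<equiv> of_real a * z^3 + of_real b * z\<^sup>2 + of_real c * z + of_real d"
    and "Qs \<equiv> of_real d * z^3 + of_real c * z\<^sup>2 + of_real b * z + of_real a"
  assumes a: "\<bar>d\<bar> < a" and r0: "\<bar>a * c - d * b\<bar> \<le> a\<^sup>2 - d\<^sup>2"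
    and r1: "\<bar>a * b - d * c\<bar> \<le> (a\<^sup>2 - d\<^sup>2) + (a * c - d * b)" and z: "norm z < 1"
  shows "norm Q < norm Qs"
proof (rule schur_step)
  have "d\<^sup>2 < a\<^sup>2" using a by (intro power2_strict_mono) auto
  then show "norm (of_real (a\<^sup>2 - d\<^sup>2) * z\<^sup>2 + of_real (a * b - d * c) * z + of_real (a * c - d * b))
      \<le> norm (of_real (a * c - d * b) * z\<^sup>2 + of_real (a * b - d * c) * z + of_real (a\<^sup>2 - d\<^sup>2))"
    "of_real (a * c - d * b) * z\<^sup>2 + of_real (a * b - d * c) * z + of_real (a\<^sup>2 - d\<^sup>2) \<noteq> 0"
    using schur_quadratic[OF _ r0 r1 z] by simp_all
  show "\<bar>d / a\<bar> < 1" "norm z < 1" "1 / a \<noteq> 0" using a z by auto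
  show "Q - of_real (d / a) * Qs = of_real (1 / a) *
      (z * (of_real (a\<^sup>2 - d\<^sup>2) * z\<^sup>2 + of_real (a * b - d * c) * z + of_real (a * c - d * b)))"
    "Qs - of_real (d / a) * Q = of_real (1 / a) *
      (of_real (a * c - d * b) * z\<^sup>2 + of_real (a * b - d * c) * z + of_real (a\<^sup>2 - d\<^sup>2))"
    unfolding Q_def Qs_def using a by (auto simp: field_simps power2_eq_square power3_eq_cube)
qed

section \<open>The bound on the dilatation of the combination in the two cases\<close>

text \<open>\<open>M\<close> is its own reversal in degree 3 and \<open>N\<close> in degree 2, so
  for P = \<open>M + z * N\<close> the reversal P* is \<open>M + N\<close>. As P is monic with P(0)
  = t, a reduction with c = t leads to a quadratic.\<close>

lemma cubic_combination_le_reversal: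
  fixes \<alpha> \<beta> t :: real and z :: complex
  defines "M \<equiv> of_real t * ((1 - 2 * of_real \<alpha> * z + z\<^sup>2) * (1 + z))"
    and "N \<equiv> of_real (1 - t) * (1 - 2 * of_real \<beta> * z + z\<^sup>2)"
  assumes ab: "\<alpha> \<in> {-1..1}" "\<beta> \<in> {-1..1}" "\<beta> \<le> \<alpha>" and t: "0 \<le> t" "t \<le> 1" and z: "norm z < 1"
  shows "norm (M + z * N) \<le> norm (M + N)" "M + N \<noteq> 0"
proof -
  have "norm (M + z * N) \<le> norm (M + N) \<and> M + N \<noteq> 0"
  \<comment> \<open>The reduction needs c = t < 1. At t = 1 the term \<open>N\<close> vanishes and
    both sides equal \<open>M\<close>.\<close>
  proof (cases "t = 1")
    case True
    have "1 - 2 * of_real \<alpha> * z + z\<^sup>2 \<noteq> 0"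
      using schur_quadratic(2)[of 1 1 "- 2 * \<alpha>" z] ab z by (simp add: algebra_simps)
    moreover have "1 + z \<noteq> 0" using z by (auto simp: add_eq_0_iff)
    ultimately show ?thesis by (simp add: M_def N_def True)
  next
    case False
    have p: "t * (\<alpha> - \<beta>) \<le> t * 2" "0 \<le> t * (\<alpha> - \<beta>)" using ab t by (auto intro!: mult_left_mono)
    have q: "t * \<alpha> \<le> t" "- t \<le> t * \<beta>" "- t \<le> t * \<alpha>"
      using ab t mult_left_mono[of \<alpha> 1 t] mult_left_mono[of "-1" \<beta> t] mult_left_mono[of "-1" \<alpha> t] by auto
    have s: "(1 - t) * \<beta> \<le> (1 - t) * 1" "(1 - t) * (-1) \<le> (1 - t) * \<beta>"
      using ab t by (intro mult_left_mono; auto)+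
    have "norm (M + z * N) < norm (M + N)"
    proof (rule schur_step)
      show "\<bar>t\<bar> < 1" "1 - t \<noteq> 0" "norm z < 1" using t False z by auto
      let ?A = "1 + t" and ?B = "- 2 * (\<beta> + \<alpha> * t)" and ?C = "1 + t - 2 * t * (\<alpha> - \<beta>)"
      have "\<bar>?C\<bar> \<le> ?A" using p t by (auto simp: abs_le_iff)
      moreover have "\<bar>?B\<bar> \<le> ?A + ?C" using p q s ab t by (auto simp: abs_le_iff algebra_simps)
      ultimately show "norm (of_real ?A * z\<^sup>2 + of_real ?B * z + of_real ?C)
          \<le> norm (of_real ?C * z\<^sup>2 + of_real ?B * z + of_real ?A)"
        "of_real ?C * z\<^sup>2 + of_real ?B * z + of_real ?A \<noteq> 0"
        using schur_quadratic[of ?A ?C ?B z] t z by linarith+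
      show "(M + z * N) - of_real t * (M + N)
          = of_real (1 - t) * (z * (of_real ?A * z\<^sup>2 + of_real ?B * z + of_real ?C))"
        "(M + N) - of_real t * (M + z * N)
          = of_real (1 - t) * (of_real ?C * z\<^sup>2 + of_real ?B * z + of_real ?A)"
        unfolding M_def N_def by (simp_all add: algebra_simps power2_eq_square)
    qed
    then show ?thesis by auto
  qed
  then show "norm (M + z * N) \<le> norm (M + N)" "M + N \<noteq> 0" by auto
qed

text \<open>\<open>M\<close> is its own reversal in degree 4, while \<open>N\<close> changes sign
  under reversal in degree 3, so for P = \<open>M - z * N\<close> the reversal P* is
  \<open>M + N\<close>. Again P(0) = t; a reduction with c = t leads to a cubic and
  \<open>schur_cubic\<close> performs the next one.\<close>

lemma quartic_combination_le_reversal: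
  fixes \<alpha> \<beta> t :: real and z :: complex
  defines "M \<equiv> of_real t * ((1 - 2 * of_real \<alpha> * z + z\<^sup>2) * (1 + z\<^sup>2))"
    and "N \<equiv> of_real (1 - t) * ((1 - 2 * of_real \<beta> * z + z\<^sup>2) * (1 - z))"
  assumes ab: "\<alpha> \<in> {-1..1}" "\<beta> \<in> {-1..1}" "\<bar>\<beta>\<bar> \<le> \<bar>\<alpha>\<bar>" "\<alpha> * \<beta> \<ge> 0"
    and t: "0 \<le> t" "t \<le> 1" and z: "norm z < 1"
  shows "norm (M - z * N) \<le> norm (M + N)" "M + N \<noteq> 0"
proof -
  have nz: "1 - 2 * of_real \<gamma> * z + z\<^sup>2 \<noteq> 0" if "\<gamma> \<in> {-1..1}" for \<gamma>
    using schur_quadratic(2)[of 1 1 "- 2 * \<gamma>" z] that z by (auto simp: algebra_simps abs_le_iff)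
  have nz1: "1 + z\<^sup>2 \<noteq> 0" using nz[of 0] by simp
  have nz2: "1 - z \<noteq> 0" using z by auto
  have sgn: "(0 \<le> \<beta> \<and> \<beta> \<le> \<alpha>) \<or> (\<alpha> \<le> \<beta> \<and> \<beta> \<le> 0)"
    using ab(3,4) by (auto simp: zero_le_mult_iff)
  \<comment> \<open>At t = 1 the first reduction breaks down since c = 1, at t = 0 the second one
    since the reduced cubic has d = -a.\<close>
  consider "t = 1" | "t = 0" | "0 < t" "t < 1" using t by linarith
  then have "norm (M - z * N) \<le> norm (M + N) \<and> M + N \<noteq> 0"
  proof cases
    case 1
    then show ?thesis using nz[OF ab(1)] nz1 by (simp add: M_def N_def)
  next
    case 2
    have "norm z * norm N \<le> 1 * norm N" using z by (intro mult_right_mono) auto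
    then show ?thesis using nz[OF ab(2)] nz2 2 by (simp add: M_def N_def norm_mult)
  next
    case 3
    define a where "a = 1 + t"
    define b where "b = t - 1 - 2 * \<alpha> * t - 2 * \<beta>"
    define c where "c = 1 + t + 2 * \<beta> * (1 - t)"
    define d where "d = t - 1 - 2 * t * (\<alpha> - \<beta>)"
    let ?Q = "of_real a * z^3 + of_real b * z\<^sup>2 + of_real c * z + of_real d"
    let ?Qs = "of_real d * z^3 + of_real c * z\<^sup>2 + of_real b * z + of_real a"
    have "norm ?Q \<le> norm ?Qs \<and> ?Qs \<noteq> 0"
    \<comment> \<open>This is the other degenerate case d = -a. The sign condition leaves only
      \<alpha> = 1, \<beta> = 0, and then the cubic is minus its own reversal.\<close>
    proof (cases "\<alpha> - \<beta> = 1")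
      case True
      then have e: "\<alpha> = 1" "\<beta> = 0" using ab sgn by auto
      have "?Q = of_real a * ((z - 1) * (1 + z\<^sup>2))" "?Qs = - ?Q"
        unfolding a_def b_def c_def d_def e
        by (simp_all add: algebra_simps power2_eq_square power3_eq_cube)
      moreover have "a \<noteq> 0" using t by (simp add: a_def)
      ultimately show ?thesis using nz1 nz2 by simp
    next
      case False
      then have "\<alpha> - \<beta> < 1" "- 1 \<le> \<alpha> - \<beta>" using ab sgn by auto
      then have p: "t * (\<alpha> - \<beta>) < t * 1" "t * (-1) \<le> t * (\<alpha> - \<beta>)"
        using 3 by (intro mult_strict_left_mono mult_left_mono; simp)+
      then have d: "\<bar>d\<bar> < a" unfolding a_def d_def using 3 by (auto simp: abs_less_iff)
      \<comment> \<open>\<open>u\<close> and \<open>v\<close> are the values of the cubic at 1 and,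
        up to sign, at -1: u = a + b + c + d and v = a - b + c - d. The two halves of
        \<open>r1\<close> factor as (a - d) u \<ge> 0 and (a + d) v \<ge> 0.\<close>
      define u where "u = 4 * t * (1 - \<alpha>)"
      define v where "v = 4 * (1 + \<alpha> * t + \<beta> * (1 - t))"
      have "t * (-1) \<le> t * \<alpha>" "(1 - t) * (-1) \<le> (1 - t) * \<beta>"
        using ab t by (intro mult_left_mono; auto)+
      then have v: "v \<ge> 0" unfolding v_def by (simp add: algebra_simps)
      have u: "u \<ge> 0" unfolding u_def using ab t by simp
      have "0 \<le> (a - d) * u" "0 \<le> (a + d) * v" using u v d by (auto intro!: mult_nonneg_nonneg)
      moreover have "(a - d) * u = (a\<^sup>2 - d\<^sup>2) + (a * c - d * b) + (a * b - d * c)"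
        "(a + d) * v = (a\<^sup>2 - d\<^sup>2) + (a * c - d * b) - (a * b - d * c)"
        unfolding a_def b_def c_def d_def u_def v_def by (simp_all add: algebra_simps power2_eq_square)
      ultimately have r1: "\<bar>a * b - d * c\<bar> \<le> (a\<^sup>2 - d\<^sup>2) + (a * c - d * b)" by linarith
      \<comment> \<open>The conditions on signs and moduli of \<alpha>, \<beta> give the upper bound
        on ac - db; the lower bound is already contained in \<open>r1\<close>.\<close>
      have "0 \<le> \<beta> * (\<alpha> - \<beta>)" using sgn by (auto simp: zero_le_mult_iff)
      then have "0 \<le> 4 * t * (1 + t) * (\<beta> * (\<alpha> - \<beta>))" using t by simp
      also have "\<dots> = (a\<^sup>2 - d\<^sup>2) - (a * c - d * b)"
        unfolding a_def b_def c_def d_def by (simp add: algebra_simps power2_eq_square)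
      finally have "\<bar>a * c - d * b\<bar> \<le> a\<^sup>2 - d\<^sup>2" using r1 by linarith
      from schur_cubic[OF d this r1 z] show ?thesis by auto
    qed
    then have "norm (M - z * N) < norm (M + N)"
    proof (elim conjE, intro schur_step)
      show "\<bar>t\<bar> < 1" "1 - t \<noteq> 0" "norm z < 1" using 3 z by auto
      show "(M - z * N) - of_real t * (M + N) = of_real (1 - t) * (z * ?Q)"
        "(M + N) - of_real t * (M - z * N) = of_real (1 - t) * ?Qs"
        unfolding M_def N_def a_def b_def c_def d_def
        by (simp_all add: algebra_simps power2_eq_square power3_eq_cube)
    qed
    then show ?thesis by auto
  qed
  then show "norm (M - z * N) \<le> norm (M + N)" "M + N \<noteq> 0" by auto
qed

section \<open>Shearing along level curves of the real part\<close>

text \<open>Since Re f = Re (h + g), each vertical slice of the image is the image of one level set.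
  Parametrising that set over the whole real line reduces both claims to the behaviour of Im f along
  one curve: injectivity for univalence, continuity for connected slices.\<close>

lemma harmonic_shear:
  assumes hol: "h holomorphic_on unit_disk" "g holomorphic_on unit_disk"
    and dil: "\<And>z. z \<in> unit_disk \<Longrightarrow> norm (deriv g z) < norm (deriv h z)"
    and level: "\<And>z\<^sub>0. z\<^sub>0 \<in> unit_disk \<Longrightarrow>
      \<exists>p p'. (\<forall>m::real. (p has_vector_derivative p' m) (at m) \<and> p' m \<noteq> 0) \<and>
        range p = {z \<in> unit_disk. Re (h z + g z) = Re (h z\<^sub>0 + g z\<^sub>0)}"
  defines "f \<equiv> (\<lambda>z. h z + cnj (g z))"
  shows "inj_on f unit_disk" "convex_imag_dir (f ` unit_disk)"
proof -
  have param: "\<exists>p. inj (\<lambda>m::real. f (p m)) \<and> connected (range (\<lambda>m. f (p m))) \<and>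
      range p = {z \<in> unit_disk. Re (f z) = Re (f z\<^sub>0)}" if "z\<^sub>0 \<in> unit_disk" for z\<^sub>0
  proof -
    from level[OF that] obtain p p' where
      p: "\<And>m::real. (p has_vector_derivative p' m) (at m)" "\<And>m. p' m \<noteq> 0"
      and ran: "range p = {z \<in> unit_disk. Re (h z + g z) = Re (h z\<^sub>0 + g z\<^sub>0)}"
      by blast
    \<comment> \<open>\<open>k\<close> is Im f along the curve; conjugating g changes the sign of
      its imaginary part.\<close>
    define k where "k = (\<lambda>m. Im (h (p m) - g (p m)))"
    have in_disk: "p m \<in> unit_disk" for m using ran by auto
    have const: "Re (h (p m) + g (p m)) = Re (h z\<^sub>0 + g z\<^sub>0)" for m using ran by auto
    have fd: "(q has_field_derivative deriv q (p m)) (at (p m))"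
      if "q holomorphic_on unit_disk" for q m
      using that in_disk[of m] by (auto intro!: holomorphic_derivI simp: unit_disk_def)
    have hp: "((\<lambda>m. h (p m)) has_vector_derivative p' m * deriv h (p m)) (at m)" for m
      using field_vector_diff_chain_at[OF p(1) fd[OF hol(1)]] by (simp add: o_def)
    have gp: "((\<lambda>m. g (p m)) has_vector_derivative p' m * deriv g (p m)) (at m)" for m
      using field_vector_diff_chain_at[OF p(1) fd[OF hol(2)]] by (simp add: o_def)
    have kd: "(k has_real_derivative Im (p' m * deriv h (p m) - p' m * deriv g (p m))) (at m)" for m
      unfolding k_def has_real_derivative_iff_has_vector_derivative
      by (intro bounded_linear.has_vector_derivative[OF bounded_linear_Im] has_vector_derivative_diff hp gp)
    have "((\<lambda>m. Re (h (p m) + g (p m))) has_real_derivative Re (p' m * deriv h (p m) + p' m * deriv g (p m))) (at m)" for m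
      unfolding has_real_derivative_iff_has_vector_derivative
      by (intro bounded_linear.has_vector_derivative[OF bounded_linear_Re] has_vector_derivative_add hp gp)
    then have "((\<lambda>m::real. Re (h z\<^sub>0 + g z\<^sub>0)) has_real_derivative Re (p' m * deriv h (p m) + p' m * deriv g (p m))) (at m)" for m
      unfolding const .
    then have re0: "Re (p' m * deriv h (p m) + p' m * deriv g (p m)) = 0" for m
      by (rule DERIV_unique) simp
    \<comment> \<open>Otherwise g' p' is minus the conjugate of h' p', against the dilatation bound.\<close>
    have kd0: "Im (p' m * deriv h (p m) - p' m * deriv g (p m)) \<noteq> 0" for m
    proof
      assume "Im (p' m * deriv h (p m) - p' m * deriv g (p m)) = 0"
      with re0[of m] have "p' m * deriv g (p m) = - cnj (p' m * deriv h (p m))"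
        by (auto simp: complex_eq_iff)
      then have "norm (p' m * deriv g (p m)) = norm (p' m * deriv h (p m))"
        by (metis complex_mod_cnj norm_minus_cancel)
      then show False using dil[OF in_disk[of m]] p(2)[of m] by (simp add: norm_mult)
    qed
    \<comment> \<open>By Rolle, a derivative without zeros suffices for injectivity; its sign need
      not be determined.\<close>
    have k_neq: "k m \<noteq> k n" if mn: "m < n" for m n
    proof
      assume "k m = k n"
      have "continuous_on {m..n} k"
        by (intro continuous_at_imp_continuous_on ballI DERIV_isCont[OF kd])
      moreover have "k differentiable (at x)" for x
        using kd[of x] unfolding real_differentiable_def by blast
      ultimately obtain x where "DERIV k x :> 0" using Rolle[OF mn \<open>k m = k n\<close>] by blast
      then show False using DERIV_unique[OF _ kd[of x]] kd0[of x] by force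
    qed
    have "Im (f (p m)) = k m" for m by (simp add: f_def k_def)
    then have "inj (\<lambda>m. f (p m))" using k_neq by (metis injI linorder_neqE)
    moreover have "((\<lambda>m. f (p m)) has_vector_derivative p' m * deriv h (p m) + cnj (p' m * deriv g (p m))) (at m)" for m
      unfolding f_def
      by (intro has_vector_derivative_add hp bounded_linear.has_vector_derivative[OF bounded_linear_cnj] gp)
    then have "continuous_on UNIV (\<lambda>m. f (p m))"
      by (intro continuous_at_imp_continuous_on) (auto intro: has_vector_derivative_continuous)
    then have "connected (range (\<lambda>m. f (p m)))"
      by (intro connected_continuous_image) auto
    moreover have "range p = {z \<in> unit_disk. Re (f z) = Re (f z\<^sub>0)}" using ran by (simp add: f_def)
    ultimately show ?thesis by blast
  qed
  show "inj_on f unit_disk"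
  proof
    fix z w assume zw: "z \<in> unit_disk" "w \<in> unit_disk" "f z = f w"
    obtain p where p: "inj (\<lambda>m::real. f (p m))" "range p = {w \<in> unit_disk. Re (f w) = Re (f z)}"
      using param[OF zw(1)] by blast
    have "z \<in> range p" "w \<in> range p" unfolding p(2) using zw by auto
    then show "z = w" using zw(3) injD[OF p(1)] by blast
  qed
  show "convex_imag_dir (f ` unit_disk)"
    unfolding convex_imag_dir_def
  proof
    fix x :: real
    show "connected (f ` unit_disk \<inter> {w. Re w = x})"
    proof (cases "\<exists>z\<^sub>0\<in>unit_disk. Re (f z\<^sub>0) = x")
      case False
      then have "f ` unit_disk \<inter> {w. Re w = x} = {}" by auto
      then show ?thesis by simp
    next
      case True
      then obtain z\<^sub>0 where z0: "z\<^sub>0 \<in> unit_disk" "Re (f z\<^sub>0) = x" by blast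
      obtain p where p: "connected (range (\<lambda>m::real. f (p m)))" "range p = {w \<in> unit_disk. Re (f w) = Re (f z\<^sub>0)}"
        using param[OF z0(1)] by blast
      have "f ` unit_disk \<inter> {w. Re w = x} = f ` range p" unfolding p(2) using z0 by auto
      then show ?thesis using p(1) by (simp add: image_image)
    qed
  qed
qed

section \<open>Level curves of the sum in the half-plane coordinate\<close>

text \<open>The left-hand side is Re (a\<zeta> - b/\<zeta>) at \<zeta> = x (1 + im), strictly
  increasing in x > 0. The point given by \<open>x\<^sub>0\<close>, \<open>m\<^sub>0\<close> shows
  that the level k is attained on one ray; this fixes the sign of k when a = 0 or b = 0, so that k
  is attained on every ray.\<close>

lemma level_radius:
  fixes a b k x\<^sub>0 m\<^sub>0 :: real
  assumes ab: "a \<ge> 0" "b \<ge> 0" "a + b > 0" and x0: "x\<^sub>0 > 0" "a * x\<^sub>0 - b / (x\<^sub>0 * (1 + m\<^sub>0\<^sup>2)) = k"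
  shows "\<exists>X X'. \<forall>m. X m > 0 \<and> (X has_real_derivative X' m) (at m) \<and>
           (\<forall>x>0. a * x - b / (x * (1 + m\<^sup>2)) = k \<longleftrightarrow> x = X m)"
proof -
  have m1: "1 + m\<^sup>2 > 0" for m :: real by (simp add: add_pos_nonneg)
  show ?thesis
  proof (cases "a = 0")
    case True
    then have b: "b > 0" using ab by simp
    then have k: "k < 0" using x0 m1[of m\<^sub>0] True by auto
    define X where "X = (\<lambda>m. - b / (k * (1 + m\<^sup>2)))"
    have pos: "X m > 0" for m
      unfolding X_def using b k m1[of m] by (intro divide_neg_neg mult_neg_pos) auto
    have der: "(X has_real_derivative 2 * b * m / (k * (1 + m\<^sup>2)\<^sup>2)) (at m)" for m
    proof -
      have n: "1 + m\<^sup>2 \<noteq> 0" "k \<noteq> 0" using m1[of m] k by auto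
      have "((\<lambda>m. - b / k * inverse (1 + m\<^sup>2)) has_real_derivative
          - b / k * - (inverse (1 + m\<^sup>2) * (2 * m) * inverse (1 + m\<^sup>2))) (at m)"
        by (rule derivative_eq_intros refl n | simp)+
      moreover have "(\<lambda>m. - b / k * inverse (1 + m\<^sup>2)) = X"
        by (auto simp: X_def divide_inverse)
      moreover have "- b / k * - (inverse (1 + m\<^sup>2) * (2 * m) * inverse (1 + m\<^sup>2)) = 2 * b * m / (k * (1 + m\<^sup>2)\<^sup>2)"
        by (simp add: divide_inverse power2_eq_square)
      ultimately show ?thesis by simp
    qed
    have iff: "a * x - b / (x * (1 + m\<^sup>2)) = k \<longleftrightarrow> x = X m" if "x > 0" for x m
    proof -
      define n where "n = 1 + m\<^sup>2"
      have "n \<noteq> 0" "x \<noteq> 0" "k \<noteq> 0" using that m1[of m] k by (auto simp: n_def)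
      then show ?thesis unfolding X_def True n_def[symmetric] by auto
    qed
    show ?thesis
      by (rule exI[of _ X], rule exI[of _ "\<lambda>m. 2 * b * m / (k * (1 + m\<^sup>2)\<^sup>2)"])
        (intro allI conjI impI pos der iff)
  next
    case False
    then have a: "a > 0" using ab by simp
    \<comment> \<open>\<open>D\<close> is the discriminant of a x^2 - k x - b/(1 + m^2) and
      \<open>X\<close> its larger root. The product of the roots is at most 0, so no other root can
      be positive.\<close>
    define D where "D = (\<lambda>m. k\<^sup>2 + 4 * a * (b / (1 + m\<^sup>2)))"
    define X where "X = (\<lambda>m. (k + sqrt (D m)) / (2 * a))"
    have "D m > 0 \<and> k + sqrt (D m) > 0" for m
    proof (cases "b = 0")
      case True
      then have "k > 0" using x0 a by auto
      then show ?thesis using True by (simp add: D_def)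
    next
      case False
      then have "4 * a * (b / (1 + m\<^sup>2)) > 0" using a ab m1[of m] by simp
      then have D: "D m > k\<^sup>2" by (simp add: D_def)
      then have "sqrt (D m) > \<bar>k\<bar>" using real_less_rsqrt[of "\<bar>k\<bar>"] by simp
      then show ?thesis using D by (smt (verit) zero_le_power2)
    qed
    then have D: "D m > 0" and X: "X m > 0" for m using a by (auto simp: X_def)
    have der: "(X has_real_derivative (inverse (sqrt (D m)) / 2 * (4 * a * (b * (- 2 * m) / (1 + m\<^sup>2)\<^sup>2))) / (2 * a)) (at m)" for m
    proof -
      have "(D has_real_derivative 4 * a * (b * (- 2 * m) / (1 + m\<^sup>2)\<^sup>2)) (at m)"
        unfolding D_def using m1[of m]
        by (auto intro!: derivative_eq_intros simp: field_simps power2_eq_square)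
      then have "((\<lambda>m. sqrt (D m)) has_real_derivative inverse (sqrt (D m)) / 2 * (4 * a * (b * (- 2 * m) / (1 + m\<^sup>2)\<^sup>2))) (at m)"
        using D[of m] by (intro DERIV_chain2[OF DERIV_real_sqrt])
      from DERIV_add[OF DERIV_const this, of k] show ?thesis
        unfolding X_def add_0_left by (rule DERIV_cdivide)
    qed
    have iff: "a * x - b / (x * (1 + m\<^sup>2)) = k \<longleftrightarrow> x = X m" if x: "x > 0" for x m
    proof -
      define e where "e = b / (1 + m\<^sup>2)"
      have Dm: "D m = k\<^sup>2 + 4 * a * e" by (simp add: D_def e_def)
      have e: "e \<ge> 0" using ab m1[of m] by (simp add: e_def)
      have "a * x - b / (x * (1 + m\<^sup>2)) = k \<longleftrightarrow> a * x\<^sup>2 - k * x - e = 0"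
      proof -
        have "b / (x * (1 + m\<^sup>2)) = e / x" by (simp add: e_def)
        then show ?thesis
          using x by (simp only:) (auto simp: field_simps power2_eq_square)
      qed
      also have "\<dots> \<longleftrightarrow> (2 * a * x - k)\<^sup>2 = D m"
      proof -
        have "(2 * a * x - k)\<^sup>2 - D m = 4 * a * (a * x\<^sup>2 - k * x - e)"
          unfolding Dm by (simp add: power2_eq_square algebra_simps)
        then show ?thesis using a by (smt (verit) mult_eq_0_iff)
      qed
      also have "\<dots> \<longleftrightarrow> 2 * a * x - k = sqrt (D m)"
      proof
        assume s: "(2 * a * x - k)\<^sup>2 = D m"
        \<comment> \<open>The negative square root would give 2ax = k - sqrt D \<le> 0.\<close>
        have "2 * a * x - k > - sqrt (D m)"
        proof (rule ccontr)
          assume "\<not> ?thesis"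
          then have "2 * a * x \<le> k - sqrt (D m)" by simp
          moreover have "k \<le> sqrt (D m)"
            using a e by (intro real_le_rsqrt) (simp add: Dm)
          moreover have "2 * a * x > 0" using a x by simp
          ultimately show False by linarith
        qed
        then show "2 * a * x - k = sqrt (D m)"
          unfolding s[symmetric] real_sqrt_abs by linarith
      qed (use D[of m] in simp)
      also have "\<dots> \<longleftrightarrow> x = X m" using a by (auto simp: X_def field_simps)
      finally show ?thesis .
    qed
    show ?thesis
      by (rule exI[of _ X], rule exI[of _ "\<lambda>m. (inverse (sqrt (D m)) / 2 *
          (4 * a * (b * (- 2 * m) / (1 + m\<^sup>2)\<^sup>2))) / (2 * a)"])
        (intro allI conjI impI X der iff)
  qed
qed

text \<open>Supplies the hypothesis \<open>level\<close> of \<open>harmonic_shear\<close>, with the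
  slope m of a ray in the right half-plane as parameter.\<close>

lemma level_curve:
  fixes \<alpha> :: real and z\<^sub>0 :: complex
  defines "F \<equiv> (\<lambda>z. z * (1 - of_real \<alpha> * z) / (1 - z\<^sup>2))"
  assumes \<alpha>: "\<alpha> \<in> {-1..1}" and z0: "z\<^sub>0 \<in> unit_disk"
  shows "\<exists>p p'. (\<forall>m::real. (p has_vector_derivative p' m) (at m) \<and> p' m \<noteq> 0) \<and>
           range p = {z \<in> unit_disk. Re (F z) = Re (F z\<^sub>0)}"
proof -
  \<comment> \<open>Chosen so that F(w \<zeta>) = a\<zeta> - b/\<zeta> + (b - a).\<close>
  define a b where "a = (1 - \<alpha>) / 4" and "b = (1 + \<alpha>) / 4"
  have ab: "a \<ge> 0" "b \<ge> 0" "a + b > 0" using \<alpha> by (auto simp: a_def b_def field_simps)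
  \<comment> \<open>\<open>Z m x\<close> is the point with real part x on the ray of slope m; for x
    > 0 these points cover the right half-plane once. \<open>w\<close> below is the inverse of the
    Cayley map z \<mapsto> (1 + z)/(1 - z).\<close>
  define Z :: "real \<Rightarrow> real \<Rightarrow> complex" where "Z = (\<lambda>m x. of_real x * Complex 1 m)"
  have Zm: "Re (Z m x) = x" "Im (Z m x) = x * m" for m x by (simp_all add: Z_def)
  define w :: "complex \<Rightarrow> complex" where "w = (\<lambda>\<zeta>. (\<zeta> - 1) / (\<zeta> + 1))"
  have w_in: "w \<zeta> \<in> unit_disk" if "Re \<zeta> > 0" for \<zeta>
  proof -
    have "(norm (\<zeta> - 1))\<^sup>2 < (norm (\<zeta> + 1))\<^sup>2"
      unfolding cmod_power2 using that by (simp add: power2_eq_square algebra_simps)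
    then have "norm (\<zeta> - 1) < norm (\<zeta> + 1)" by (rule power_less_imp_less_base) simp
    moreover from this have "norm (\<zeta> + 1) > 0" by (rule le_less_trans[rotated]) simp
    ultimately show ?thesis by (simp add: w_def unit_disk_def norm_divide)
  qed
  have w_surj: "\<exists>m x. x > 0 \<and> z = w (Z m x)" if "z \<in> unit_disk" for z
  proof -
    define \<zeta> where "\<zeta> = (1 + z) / (1 - z)"
    have n: "norm z < 1" using that by (simp add: unit_disk_def)
    then have z1: "1 - z \<noteq> 0" by auto
    have "\<zeta> = (1 + z) * cnj (1 - z) / of_real ((norm (1 - z))\<^sup>2)"
      unfolding \<zeta>_def by (rule complex_div_cnj)
    then have "Re \<zeta> = (1 - (norm z)\<^sup>2) / (norm (1 - z))\<^sup>2"
      by (simp only: Re_divide_of_real) (simp add: cmod_power2, simp add: power2_eq_square algebra_simps)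
    moreover have "(norm z)\<^sup>2 < 1" using n by (simp add: abs_square_less_1)
    ultimately have r: "Re \<zeta> > 0" using z1 by simp
    have "\<zeta> = Z (Im \<zeta> / Re \<zeta>) (Re \<zeta>)" using r by (simp add: complex_eq_iff Zm)
    moreover have "\<zeta> + 1 = 2 / (1 - z)" "\<zeta> - 1 = 2 * z / (1 - z)"
      using z1 by (simp_all add: \<zeta>_def field_simps)
    then have "w \<zeta> = z" using z1 by (simp add: w_def)
    ultimately show ?thesis using r by metis
  qed
  have Fw: "Re (F (w (Z m x))) = a * x - b / (x * (1 + m\<^sup>2)) + (b - a)" if x: "x > 0" for m x
  proof -
    let ?\<zeta> = "Z m x"
    have n: "?\<zeta> \<noteq> 0" "?\<zeta> + 1 \<noteq> 0" using x Zm[of m x] by (auto simp: complex_eq_iff)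
    define s where "s = ?\<zeta> + 1"
    have s: "s \<noteq> 0" "?\<zeta> = s - 1" using n by (simp_all add: s_def)
    have d: "1 - (w ?\<zeta>)\<^sup>2 = 4 * ?\<zeta> / (?\<zeta> + 1)\<^sup>2"
      using s(1) unfolding w_def s(2) by (simp add: power_divide field_simps power2_eq_square)
    have e: "w ?\<zeta> * (1 - of_real \<alpha> * w ?\<zeta>) = (?\<zeta> - 1) * (?\<zeta> + 1 - of_real \<alpha> * (?\<zeta> - 1)) / (?\<zeta> + 1)\<^sup>2"
      using s(1) unfolding w_def s(2) by (simp add: field_simps power2_eq_square)
    have "F (w ?\<zeta>) = (?\<zeta> - 1) * (?\<zeta> + 1 - of_real \<alpha> * (?\<zeta> - 1)) / (4 * ?\<zeta>)"
      unfolding F_def d e using n by simp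
    also have "\<dots> = of_real a * ?\<zeta> - of_real b * (1 / ?\<zeta>) + of_real (b - a)"
      using n by (simp add: a_def b_def field_simps)
    finally have "Re (F (w ?\<zeta>)) = a * Re ?\<zeta> - b * Re (1 / ?\<zeta>) + (b - a)"
      by (simp only: minus_complex.sel plus_complex.sel Re_complex_of_real times_complex.sel Im_complex_of_real
          mult_zero_left diff_zero)
    moreover have "Re (1 / ?\<zeta>) = 1 / (x * (1 + m\<^sup>2))"
    proof -
      have "x\<^sup>2 + (x * m)\<^sup>2 = x * (x * (1 + m\<^sup>2))"
        by (simp add: power2_eq_square algebra_simps)
      then show ?thesis unfolding Re_divide Zm using x by simp
    qed
    ultimately show ?thesis by (simp add: Zm)
  qed
  obtain m\<^sub>0 x\<^sub>0 where x0: "x\<^sub>0 > 0" "z\<^sub>0 = w (Z m\<^sub>0 x\<^sub>0)" using w_surj[OF z0] by blast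
  obtain X X' where X: "\<And>m. X m > 0" "\<And>m. (X has_real_derivative X' m) (at m)"
    and Xeq: "\<And>m x. x > 0 \<Longrightarrow> a * x - b / (x * (1 + m\<^sup>2)) = a * x\<^sub>0 - b / (x\<^sub>0 * (1 + m\<^sub>0\<^sup>2)) \<longleftrightarrow> x = X m"
    using level_radius[OF ab x0(1) refl, of m\<^sub>0] by blast
  define q' where "q' = (\<lambda>m. of_real (X' m) * Complex 1 m + of_real (X m) * \<i>)"
  define p where "p = (\<lambda>m. w (Z m (X m)))"
  have "(p has_vector_derivative q' m * (2 / (Z m (X m) + 1)\<^sup>2)) (at m)" for m
  proof -
    have n: "Z m (X m) + 1 \<noteq> 0" using X(1)[of m] Zm[of m "X m"] by (auto simp: complex_eq_iff)
    have "((\<lambda>m. of_real (X m) * (1 + of_real m * \<i>)) has_vector_derivative q' m) (at m)"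
      unfolding q'_def
      by (rule derivative_eq_intros X(2) refl | simp add: Complex_eq has_real_derivative_iff_has_vector_derivative[symmetric] X(2))+
    then have "((\<lambda>m. Z m (X m)) has_vector_derivative q' m) (at m)"
      by (simp add: Z_def Complex_eq mult.commute)
    moreover have "(w has_field_derivative 2 / (Z m (X m) + 1)\<^sup>2) (at (Z m (X m)))"
      unfolding w_def using n by (auto intro!: derivative_eq_intros simp: field_simps power2_eq_square)
    ultimately show ?thesis
      using field_vector_diff_chain_at unfolding p_def o_def by blast
  qed
  moreover have "q' m * (2 / (Z m (X m) + 1)\<^sup>2) \<noteq> 0" for m
  proof -
    have "Z m (X m) + 1 \<noteq> 0" using X(1)[of m] Zm[of m "X m"] by (auto simp: complex_eq_iff)
    \<comment> \<open>The real part of \<open>q' m\<close> is X' and the imaginary part m X' + X; if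
      both vanished, then X = 0.\<close>
    moreover have "q' m \<noteq> 0" using X(1)[of m] by (auto simp: q'_def complex_eq_iff)
    ultimately show ?thesis by simp
  qed
  moreover have "range p = {z \<in> unit_disk. Re (F z) = Re (F z\<^sub>0)}"
  proof (intro set_eqI iffI)
    fix z assume "z \<in> range p"
    then obtain m where "z = w (Z m (X m))" by (auto simp: p_def)
    then show "z \<in> {z \<in> unit_disk. Re (F z) = Re (F z\<^sub>0)}"
      using X(1)[of m] Xeq[of "X m" m] x0 by (auto simp: Fw Zm intro!: w_in)
  next
    fix z assume z: "z \<in> {z \<in> unit_disk. Re (F z) = Re (F z\<^sub>0)}"
    then obtain m x where x: "x > 0" "z = w (Z m x)" using w_surj by blast
    with z x0 have "x = X m" using Xeq[OF x(1), of m] by (simp add: Fw)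
    then show "z \<in> range p" using x by (auto simp: p_def)
  qed
  ultimately show ?thesis
    by (intro exI[of _ p] exI[of _ "\<lambda>m. q' m * (2 / (Z m (X m) + 1)\<^sup>2)"] conjI allI)
qed


section \<open>From the dilatation bound to univalence, and the derivatives of the given
  mappings\<close>

text \<open>The strict inequality between the derivatives also makes h' nonzero, so it yields local
  univalence as well as the hypothesis of the shear; \<open>level_curve\<close> provides the level
  sets.\<close>

lemma shear_in_SH:
  fixes \<alpha> :: real
  assumes hol: "h holomorphic_on unit_disk" "g holomorphic_on unit_disk"
    and \<alpha>: "\<alpha> \<in> {-1..1}"
    and sum: "\<And>z. z \<in> unit_disk \<Longrightarrow> h z + g z = z * (1 - of_real \<alpha> * z) / (1 - z\<^sup>2)"
    and dil: "\<And>z. z \<in> unit_disk \<Longrightarrow> norm (deriv g z) < norm (deriv h z)"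
    and norm: "h 0 + cnj (g 0) = 0" "deriv h 0 = 1"
  shows "in_SH (\<lambda>z. h z + cnj (g z)) \<and> convex_imag_dir ((\<lambda>z. h z + cnj (g z)) ` unit_disk)"
proof -
  have "\<exists>p p'. (\<forall>m::real. (p has_vector_derivative p' m) (at m) \<and> p' m \<noteq> 0) \<and>
      range p = {z \<in> unit_disk. Re (h z + g z) = Re (h z\<^sub>0 + g z\<^sub>0)}" if "z\<^sub>0 \<in> unit_disk" for z\<^sub>0
    using level_curve[OF \<alpha> that] that by (simp add: sum cong: conj_cong)
  note shear = harmonic_shear[OF hol dil this]
  have "deriv h z \<noteq> 0 \<and> norm (deriv g z / deriv h z) < 1" if "z \<in> unit_disk" for z
    using dil[OF that] by (auto simp: norm_divide divide_less_eq_1)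
  then show ?thesis
    unfolding in_SH_def using hol norm shear by blast
qed

text \<open>Together with g' = \<omega> h' this determines (1 + \<omega>) h' explicitly.\<close>

lemma deriv_shear_sum:
  fixes \<alpha> :: real
  assumes hol: "h holomorphic_on unit_disk" "g holomorphic_on unit_disk"
    and sum: "\<forall>z\<in>unit_disk. h z + g z = z * (1 - of_real \<alpha> * z) / (1 - z\<^sup>2)"
    and z: "z \<in> unit_disk"
  shows "deriv h z + deriv g z = (1 - 2 * of_real \<alpha> * z + z\<^sup>2) / (1 - z\<^sup>2)\<^sup>2"
proof -
  have o: "open unit_disk" by (simp add: unit_disk_def)
  have n: "1 - z\<^sup>2 \<noteq> 0" using z by (auto simp: unit_disk_def power2_eq_1_iff)
  have "((\<lambda>z. z * (1 - of_real \<alpha> * z) / (1 - z\<^sup>2)) has_field_derivative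
      (1 - 2 * of_real \<alpha> * z + z\<^sup>2) / (1 - z\<^sup>2)\<^sup>2) (at z)"
    using n by (auto intro!: derivative_eq_intros simp: power2_eq_square algebra_simps)
  then have "((\<lambda>z. h z + g z) has_field_derivative
      (1 - 2 * of_real \<alpha> * z + z\<^sup>2) / (1 - z\<^sup>2)\<^sup>2) (at z)"
    by (rule has_field_derivative_transform_within_open[OF _ o z]) (use sum in simp)
  moreover have "((\<lambda>z. h z + g z) has_field_derivative deriv h z + deriv g z) (at z)"
    by (intro DERIV_add holomorphic_derivI[OF hol(1) o z] holomorphic_derivI[OF hol(2) o z])
  ultimately show ?thesis by (rule DERIV_unique[symmetric])
qed

text \<open>The quotient hypothesis is void at zeros of h'. Such zeros are excluded away from 0
  because \<omega> does not vanish there, and continuity settles the origin.\<close>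

lemma dilatation_mult:
  assumes hol: "h holomorphic_on unit_disk" "g holomorphic_on unit_disk"
    and \<omega>: "continuous_on unit_disk \<omega>" "\<And>z. z \<in> unit_disk \<Longrightarrow> z \<noteq> 0 \<Longrightarrow> \<omega> z \<noteq> 0"
    and dil: "\<forall>z\<in>unit_disk. deriv g z / deriv h z = \<omega> z"
    and z: "z \<in> unit_disk"
  shows "deriv g z = \<omega> z * deriv h z"
proof (cases "z = 0")
  case False
  \<comment> \<open>Because x / 0 = 0, a zero of h' would force \<omega> to vanish at z.\<close>
  then have "deriv h z \<noteq> 0" using dil \<omega>(2)[OF z] z by force
  then show ?thesis using dil z by (auto simp: divide_eq_eq)
next
  case True
  have o: "open unit_disk" by (simp add: unit_disk_def)
  define d where "d = (\<lambda>z. deriv g z - \<omega> z * deriv h z)"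
  have d0: "d w = 0" if "w \<in> unit_disk" "w \<noteq> 0" for w
  proof -
    have "deriv h w \<noteq> 0" using dil \<omega>(2)[OF that] that by force
    then show ?thesis using dil that by (auto simp: d_def divide_eq_eq)
  qed
  have "continuous_on unit_disk d" unfolding d_def
    by (intro continuous_intros \<omega>(1) holomorphic_on_imp_continuous_on[OF holomorphic_deriv] hol o)
  then have "isCont d z" using o z by (simp add: continuous_on_eq_continuous_at)
  then have "d \<midarrow>z\<rightarrow> d z" by (simp add: isCont_def)
  moreover have "d \<midarrow>z\<rightarrow> 0"
    by (rule tendsto_eventually) (use o z d0 True in \<open>auto simp: eventually_at_topological\<close>)
  ultimately have "d z = 0" by (rule LIM_unique)
  then show ?thesis by (simp add: d_def)
qed

section \<open>Convex combinations of two sheared mappings\<close>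

theorem theorem2p9:
  fixes h1 g1 h2 g2 :: "complex \<Rightarrow> complex" and \<alpha>1 \<alpha>2 t :: real
  assumes a1: "\<alpha>1 \<in> {-1..1}" and a2: "\<alpha>2 \<in> {-1..1}"
    and hol: "h1 holomorphic_on unit_disk" "g1 holomorphic_on unit_disk"
             "h2 holomorphic_on unit_disk" "g2 holomorphic_on unit_disk"
    and SH1: "in_SH (\<lambda>z. h1 z + cnj (g1 z))"
    and SH2: "in_SH (\<lambda>z. h2 z + cnj (g2 z))"
    and sum1: "\<forall>z\<in>unit_disk. h1 z + g1 z = z * (1 - of_real \<alpha>1 * z) / (1 - z\<^sup>2)"
    and sum2: "\<forall>z\<in>unit_disk. h2 z + g2 z = z * (1 - of_real \<alpha>2 * z) / (1 - z\<^sup>2)"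
    and dil1: "\<forall>z\<in>unit_disk. deriv g1 z / deriv h1 z = - z"
    and t: "0 \<le> t" "t \<le> 1"
  defines "f \<equiv> (\<lambda>z. of_real t * (h1 z + cnj (g1 z)) + of_real (1 - t) * (h2 z + cnj (g2 z)))"
  shows "((\<forall>z\<in>unit_disk. deriv g2 z / deriv h2 z = - (z\<^sup>2)) \<and> \<alpha>1 \<ge> \<alpha>2
            \<longrightarrow> in_SH f \<and> convex_imag_dir (f ` unit_disk))
       \<and> ((\<forall>z\<in>unit_disk. deriv g2 z / deriv h2 z = z\<^sup>2) \<and> \<bar>\<alpha>1\<bar> \<ge> \<bar>\<alpha>2\<bar> \<and> \<alpha>1 * \<alpha>2 \<ge> 0
            \<longrightarrow> in_SH f \<and> convex_imag_dir (f ` unit_disk))"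
proof -
  \<comment> \<open>As t is real, \<open>h\<close> and \<open>g\<close> are the analytic and
    co-analytic parts of f, and h + g has the same form as the given sums, with the averaged
    parameter \<open>\<alpha>\<close>.\<close>
  define h where "h = (\<lambda>z. of_real t * h1 z + of_real (1 - t) * h2 z)"
  define g where "g = (\<lambda>z. of_real t * g1 z + of_real (1 - t) * g2 z)"
  define \<alpha> where "\<alpha> = t * \<alpha>1 + (1 - t) * \<alpha>2"
  have o: "open unit_disk" by (simp add: unit_disk_def)
  have 0: "0 \<in> unit_disk" by (simp add: unit_disk_def)
  have f: "f = (\<lambda>z. h z + cnj (g z))"
    by (simp add: fun_eq_iff f_def h_def g_def algebra_simps)
  have "t *\<^sub>R \<alpha>1 + (1 - t) *\<^sub>R \<alpha>2 \<in> {-1..1}"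
    using t by (intro convexD[OF convex_real_interval(5) a1 a2]) auto
  then have \<alpha>: "\<alpha> \<in> {-1..1}" by (simp add: \<alpha>_def)
  have hg: "h holomorphic_on unit_disk" "g holomorphic_on unit_disk"
    unfolding h_def g_def by (intro holomorphic_intros hol)+
  have "h z + g z = of_real t * (h1 z + g1 z) + of_real (1 - t) * (h2 z + g2 z)" for z
    by (simp add: h_def g_def algebra_simps)
  then have sum: "h z + g z = z * (1 - of_real \<alpha> * z) / (1 - z\<^sup>2)" if "z \<in> unit_disk" for z
    using sum1 sum2 that
    by (simp add: \<alpha>_def add_divide_distrib[symmetric]) (simp add: algebra_simps)
  have "h1 0 + cnj (g1 0) = 0" "h2 0 + cnj (g2 0) = 0" using SH1 SH2 by (auto simp: in_SH_def)
  then have "f 0 = 0" by (simp add: f_def)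
  then have f0: "h 0 + cnj (g 0) = 0" by (simp add: f)
  have derivs: "deriv h z = of_real t * deriv h1 z + of_real (1 - t) * deriv h2 z"
    "deriv g z = of_real t * deriv g1 z + of_real (1 - t) * deriv g2 z" if "z \<in> unit_disk" for z
    unfolding h_def g_def
    by (intro DERIV_imp_deriv DERIV_add DERIV_cmult holomorphic_derivI[OF _ o that] hol)+
  note S1 = deriv_shear_sum[OF hol(1,2) sum1] and S2 = deriv_shear_sum[OF hol(3,4) sum2]
  have D1: "deriv g1 z = - z * deriv h1 z" if "z \<in> unit_disk" for z
    by (rule dilatation_mult[OF hol(1,2) _ _ dil1 that]) (auto intro!: continuous_intros)
  have nz: "1 - z \<noteq> 0" "1 + z \<noteq> 0" "1 + z\<^sup>2 \<noteq> 0" "1 - z\<^sup>2 \<noteq> 0" if "z \<in> unit_disk" for z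
  proof -
    have n: "norm z < 1" using that by (simp add: unit_disk_def)
    then show "1 - z \<noteq> 0" by auto
    show "1 + z \<noteq> 0" using n by (auto simp: add_eq_0_iff)
    have "norm (z\<^sup>2) < 1" using n by (simp add: norm_power abs_square_less_1)
    then show "1 + z\<^sup>2 \<noteq> 0" "1 - z\<^sup>2 \<noteq> 0" by (auto simp: add_eq_0_iff)
  qed
  have concl: "in_SH f \<and> convex_imag_dir (f ` unit_disk)"
    if lt: "\<And>z. z \<in> unit_disk \<Longrightarrow> norm (deriv g z) < norm (deriv h z)" and "deriv g2 0 = 0"
  proof -
    \<comment> \<open>The analytic part in \<open>in_SH\<close> is existentially quantified and not
      identified with \<open>h1\<close> or \<open>h2\<close>. The normalisation is therefore read
      off from h_i'(0) + g_i'(0) = 1 and g_i'(0) = 0.\<close>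
    have "deriv h1 0 = 1" "deriv h2 0 = 1"
      using S1[OF 0] S2[OF 0] D1[OF 0] that(2) by simp_all
    then have "deriv h 0 = 1" using derivs(1)[OF 0] by (simp flip: of_real_add)
    from shear_in_SH[OF hg \<alpha> sum lt f0 this] show ?thesis unfolding f .
  qed
  \<comment> \<open>The factor z of the dilatation -z P/P* turns the weak bound |P| \<le> |P*| into
    a strict one.\<close>
  have norm_less: "norm (c * (- z * u)) < norm (c * v)"
    if "norm u \<le> norm v" "v \<noteq> 0" "c \<noteq> 0" "norm z < 1" for c z u v :: complex
  proof -
    have "norm z * norm u \<le> norm z * norm v" using that(1) by (rule mult_left_mono) simp
    also have "\<dots> < 1 * norm v" using that by (intro mult_strict_right_mono) auto
    finally show ?thesis using that(3) by (simp add: norm_mult)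
  qed
  \<comment> \<open>Expanding the fraction by b brings both derivatives to a common
    denominator.\<close>
  have solve: "d = 1 / (q * (a * b)) * (n * b)"
    if "d * a = n / q" "a \<noteq> 0" "b \<noteq> 0" "q \<noteq> 0" for a b d n q :: complex
  proof -
    have "d = n / (q * a)" using that by (simp add: eq_divide_eq mult_ac)
    then show ?thesis using that by simp
  qed
  show ?thesis
  proof (rule conjI; rule impI; elim conjE)
    assume dil2: "\<forall>z\<in>unit_disk. deriv g2 z / deriv h2 z = - (z\<^sup>2)" and le: "\<alpha>1 \<ge> \<alpha>2"
    have D2: "deriv g2 z = - (z\<^sup>2) * deriv h2 z" if "z \<in> unit_disk" for z
      by (rule dilatation_mult[OF hol(3,4) _ _ dil2 that]) (auto intro!: continuous_intros)
    show "in_SH f \<and> convex_imag_dir (f ` unit_disk)"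
    proof (rule concl)
      show "deriv g2 0 = 0" using D2[OF 0] by simp
      fix z assume z: "z \<in> unit_disk"
      \<comment> \<open>Here 1 + \<omega>_1 = 1 - z divides 1 + \<omega>_2 = (1 - z)(1 + z), so only
        \<open>M\<close> acquires an extra factor. Then h' = c (M + N) and g' = -z c (M + z
        N).\<close>
      define c where "c = 1 / ((1 - z\<^sup>2)\<^sup>2 * ((1 - z) * (1 + z)))"
      define M where "M = of_real t * ((1 - 2 * of_real \<alpha>1 * z + z\<^sup>2) * (1 + z))"
      define N where "N = of_real (1 - t) * (1 - 2 * of_real \<alpha>2 * z + z\<^sup>2)"
      have n: "norm z < 1" using z by (simp add: unit_disk_def)
      note nz' = nz[OF z]
      have "deriv h1 z * (1 - z) = (1 - 2 * of_real \<alpha>1 * z + z\<^sup>2) / (1 - z\<^sup>2)\<^sup>2"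
        using S1[OF z] D1[OF z] by (simp add: algebra_simps)
      then have "deriv h1 z = c * ((1 - 2 * of_real \<alpha>1 * z + z\<^sup>2) * (1 + z))"
        unfolding c_def by (rule solve) (use nz' in simp_all)
      then have M: "of_real t * deriv h1 z = c * M" by (simp add: M_def)
      have "deriv h2 z * ((1 - z) * (1 + z)) = (1 - 2 * of_real \<alpha>2 * z + z\<^sup>2) / (1 - z\<^sup>2)\<^sup>2"
        using S2[OF z] D2[OF z] by (simp add: algebra_simps power2_eq_square)
      from solve[OF this, of 1] have "deriv h2 z = c * (1 - 2 * of_real \<alpha>2 * z + z\<^sup>2)"
        using nz' by (simp add: c_def)
      then have N: "of_real (1 - t) * deriv h2 z = c * N" by (simp add: N_def)
      have "deriv h z = c * (M + N)" using derivs(1)[OF z] M N by (simp add: distrib_left)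
      moreover have "deriv g z = - z * (of_real t * deriv h1 z) - z\<^sup>2 * (of_real (1 - t) * deriv h2 z)"
        using derivs(2)[OF z] D1[OF z] D2[OF z] by (simp add: algebra_simps)
      then have "deriv g z = c * (- z * (M + z * N))"
        unfolding M N by (simp add: algebra_simps power2_eq_square)
      moreover have "c \<noteq> 0" using nz' by (simp add: c_def)
      ultimately show "norm (deriv g z) < norm (deriv h z)"
        using cubic_combination_le_reversal[OF a1 a2 le t n] n norm_less unfolding M_def N_def by metis
    qed
  next
    assume dil2: "\<forall>z\<in>unit_disk. deriv g2 z / deriv h2 z = z\<^sup>2"
      and le: "\<bar>\<alpha>1\<bar> \<ge> \<bar>\<alpha>2\<bar>" "\<alpha>1 * \<alpha>2 \<ge> 0"
    have D2: "deriv g2 z = z\<^sup>2 * deriv h2 z" if "z \<in> unit_disk" for z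
      by (rule dilatation_mult[OF hol(3,4) _ _ dil2 that]) (auto intro!: continuous_intros)
    show "in_SH f \<and> convex_imag_dir (f ` unit_disk)"
    proof (rule concl)
      show "deriv g2 0 = 0" using D2[OF 0] by simp
      fix z assume z: "z \<in> unit_disk"
      \<comment> \<open>Now 1 + \<omega>_2 = 1 + z^2 has no factor in common with 1 - z, so both
        numerators are expanded. The opposite sign of \<omega>_2 gives g' = -z c (M - z N).\<close>
      define c where "c = 1 / ((1 - z\<^sup>2)\<^sup>2 * ((1 - z) * (1 + z\<^sup>2)))"
      define M where "M = of_real t * ((1 - 2 * of_real \<alpha>1 * z + z\<^sup>2) * (1 + z\<^sup>2))"
      define N where "N = of_real (1 - t) * ((1 - 2 * of_real \<alpha>2 * z + z\<^sup>2) * (1 - z))"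
      have n: "norm z < 1" using z by (simp add: unit_disk_def)
      note nz' = nz[OF z]
      have "deriv h1 z * (1 - z) = (1 - 2 * of_real \<alpha>1 * z + z\<^sup>2) / (1 - z\<^sup>2)\<^sup>2"
        using S1[OF z] D1[OF z] by (simp add: algebra_simps)
      then have "deriv h1 z = c * ((1 - 2 * of_real \<alpha>1 * z + z\<^sup>2) * (1 + z\<^sup>2))"
        unfolding c_def by (rule solve) (use nz' in simp_all)
      then have M: "of_real t * deriv h1 z = c * M" by (simp add: M_def)
      have "deriv h2 z * (1 + z\<^sup>2) = (1 - 2 * of_real \<alpha>2 * z + z\<^sup>2) / (1 - z\<^sup>2)\<^sup>2"
        using S2[OF z] D2[OF z] by (simp add: algebra_simps)
      then have "deriv h2 z = c * ((1 - 2 * of_real \<alpha>2 * z + z\<^sup>2) * (1 - z))"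
        unfolding c_def mult.commute[of "1 - z"] by (rule solve) (use nz' in simp_all)
      then have N: "of_real (1 - t) * deriv h2 z = c * N" by (simp add: N_def)
      have "deriv h z = c * (M + N)" using derivs(1)[OF z] M N by (simp add: distrib_left)
      moreover have "deriv g z = - z * (of_real t * deriv h1 z) + z\<^sup>2 * (of_real (1 - t) * deriv h2 z)"
        using derivs(2)[OF z] D1[OF z] D2[OF z] by (simp add: algebra_simps)
      then have "deriv g z = c * (- z * (M - z * N))"
        unfolding M N by (simp add: algebra_simps power2_eq_square)
      moreover have "c \<noteq> 0" using nz' by (simp add: c_def)
      ultimately show "norm (deriv g z) < norm (deriv h z)"
        using quartic_combination_le_reversal[OF a1 a2 le t n] n norm_less unfolding M_def N_def by metis
    qed
  qed
qed

end
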